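(* Let $\psi:\mathbb D\to\mathbb D$ be analytic and such that the composition operator $C_\psi:\mathscr M\to\mathscr M$, $C_\psi f=f\circ\psi$, is bounded. If $\|\psi\|_\infty=\sup_{z\in\mathbb D}|\psi(z)|=1$, then $\|C_\psi\|_e\ge1$.
   Context: $\mathbb D\subset\mathbb C$ is the open unit disk. For $\alpha\in\overline{\mathbb D}$, $\varphi_\alpha(z)=\dfrac{\alpha-z}{1-\overline\alpha z}$, $z\in\mathbb D$. The minimal M\"obius invariant space $\mathscr M$ is the set of all analytic functions $f$ on $\mathbb D$ for which there exist points $\alpha_n\in\overline{\mathbb D}$ and $\lambda=(\lambda(n))_{n\ge1}\in\ell^1$ (complex) with $f(z)=\sum_{n=1}^\infty\lambda(n)\varphi_{\alpha_n}(z)$; it is normed by $\|f\|_{\mathscr M}=\inf\|\lambda\|_{\ell^1}$, the infimum being over all such representations of $f$. The essential norm of a bounded operator $C_\psi$ on $\mathscr M$ is $\|C_\psi\|_e=\inf\{\|C_\psi-K\|: K:\mathscr M\to\mathscr M \text{ compact linear operator}\}$, with $\|\cdot\|$ the operator norm on $(\mathscr M,\|\cdot\|_{\mathscr M})$. *)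

theory Defs
  imports "HOL-Analysis.Analysis"
begin

abbreviation unit_disc :: "complex set" where
  "unit_disc \<equiv> ball 0 1"

text \<open>For \<open>cmod \<alpha> = 1\<close> this is the constant function \<open>\<alpha>\<close> on the disc.\<close>

definition moebius_map :: "complex \<Rightarrow> complex \<Rightarrow> complex" where
  "moebius_map \<alpha> z = (\<alpha> - z) / (1 - cnj \<alpha> * z)"

definition moebius_series ::
    "(complex \<Rightarrow> complex) \<Rightarrow> (nat \<Rightarrow> complex) \<Rightarrow> (nat \<Rightarrow> complex) \<Rightarrow> bool" where
  "moebius_series f \<alpha> l \<longleftrightarrow>
     (\<forall>n. \<alpha> n \<in> cball 0 1) \<and> summable (\<lambda>n. cmod (l n)) \<and>
     (\<forall>z\<in>unit_disc. (\<lambda>n. l n * moebius_map (\<alpha> n) z) sums f z)"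

text \<open>A function on the disc is encoded as a function on the whole plane that vanishes off
  the disc, so that equality on the disc becomes equality.\<close>

definition minimal_space :: "(complex \<Rightarrow> complex) set" where
  "minimal_space =
     {f. f holomorphic_on unit_disc \<and> (\<forall>z. z \<notin> unit_disc \<longrightarrow> f z = 0) \<and>
         (\<exists>\<alpha> l. moebius_series f \<alpha> l)}"

definition minimal_norm :: "(complex \<Rightarrow> complex) \<Rightarrow> real" where
  "minimal_norm f = Inf {(\<Sum>n. cmod (l n)) | \<alpha> l. moebius_series f \<alpha> l}"

lemma norm_moebius_map_le_1:
  assumes "\<alpha> \<in> cball 0 1" "z \<in> unit_disc"
  shows "cmod (moebius_map \<alpha> z) \<le> 1"
proof -
  have a: "(cmod \<alpha>)\<^sup>2 \<le> 1" and z: "(cmod z)\<^sup>2 \<le> 1"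
    using assms by (simp_all add: power_le_one)
  have "(cmod (1 - cnj \<alpha> * z))\<^sup>2 - (cmod (\<alpha> - z))\<^sup>2 = (1 - (cmod \<alpha>)\<^sup>2) * (1 - (cmod z)\<^sup>2)"
    unfolding cmod_power2 by (simp add: algebra_simps power2_eq_square)
  also have "\<dots> \<ge> 0" using a z by simp
  finally have "(cmod (\<alpha> - z))\<^sup>2 \<le> (cmod (1 - cnj \<alpha> * z))\<^sup>2" by simp
  then have "cmod (\<alpha> - z) \<le> cmod (1 - cnj \<alpha> * z)"
    by (rule power2_le_imp_le) simp
  then show ?thesis
    unfolding moebius_map_def norm_divide by (simp add: divide_le_eq_1)
qed

lemma moebius_series_zero: "moebius_series (\<lambda>z. 0) (\<lambda>n. 0) (\<lambda>n. 0)"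
  by (simp add: moebius_series_def)

lemma moebius_series_scale:
  "moebius_series f \<alpha> l \<Longrightarrow> moebius_series (\<lambda>z. c * f z) \<alpha> (\<lambda>n. c * l n)"
  unfolding moebius_series_def
  by (auto simp: norm_mult mult.assoc intro!: summable_mult sums_mult)

lemma sums_interleave:
  fixes f g :: "nat \<Rightarrow> 'a::real_normed_vector"
  assumes "f sums a" "g sums b"
  shows "(\<lambda>n. if even n then f (n div 2) else g (n div 2)) sums (a + b)"
proof -
  have "(\<lambda>n. if even n then f (n div 2) else 0) sums a"
    using assms(1)
    by (subst sums_mono_reindex[symmetric, where g = "\<lambda>n. 2 * n"])
       (auto simp: strict_mono_def elim!: evenE)
  moreover have "(\<lambda>n. if even n then 0 else g (n div 2)) sums b"
    using assms(2)
    by (subst sums_mono_reindex[symmetric, where g = "\<lambda>n. 2 * n + 1"])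
       (auto simp: strict_mono_def elim!: oddE)
  ultimately have "(\<lambda>n. (if even n then f (n div 2) else 0) + (if even n then 0 else g (n div 2)))
      sums (a + b)"
    by (rule sums_add)
  then show ?thesis
    by (rule back_subst[where P = "\<lambda>h. h sums (a + b)"]) auto
qed

lemma moebius_series_add:
  assumes "moebius_series f \<alpha> l" "moebius_series g \<beta> m"
  shows "\<exists>\<gamma> k. moebius_series (\<lambda>z. f z + g z) \<gamma> k \<and>
           (\<Sum>n. cmod (k n)) = (\<Sum>n. cmod (l n)) + (\<Sum>n. cmod (m n))"
proof -
  define \<gamma> where "\<gamma> n = (if even n then \<alpha> (n div 2) else \<beta> (n div 2))" for n
  define k where "k n = (if even n then l (n div 2) else m (n div 2))" for n
  have "(\<lambda>n. if even n then cmod (l (n div 2)) else cmod (m (n div 2))) sums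
      ((\<Sum>n. cmod (l n)) + (\<Sum>n. cmod (m n)))"
    using assms unfolding moebius_series_def
    by (intro sums_interleave[where f = "\<lambda>n. cmod (l n)" and g = "\<lambda>n. cmod (m n)"])
       (auto intro: summable_sums)
  then have k: "(\<lambda>n. cmod (k n)) sums ((\<Sum>n. cmod (l n)) + (\<Sum>n. cmod (m n)))"
    by (rule back_subst[where P = "\<lambda>h. h sums _"]) (auto simp: k_def)
  have "(\<lambda>n. k n * moebius_map (\<gamma> n) z) sums (f z + g z)" if "z \<in> unit_disc" for z
  proof -
    have "(\<lambda>n. if even n then l (n div 2) * moebius_map (\<alpha> (n div 2)) z
        else m (n div 2) * moebius_map (\<beta> (n div 2)) z) sums (f z + g z)"
      using assms that unfolding moebius_series_def
      by (intro sums_interleave[where f = "\<lambda>n. l n * moebius_map (\<alpha> n) z"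
            and g = "\<lambda>n. m n * moebius_map (\<beta> n) z"]) auto
    then show ?thesis
      by (rule back_subst[where P = "\<lambda>h. h sums _"]) (auto simp: k_def \<gamma>_def)
  qed
  moreover have "\<gamma> n \<in> cball 0 1" for n
    using assms unfolding moebius_series_def \<gamma>_def by simp
  ultimately have "moebius_series (\<lambda>z. f z + g z) \<gamma> k"
    using k unfolding moebius_series_def by (auto intro: sums_summable)
  with k show ?thesis using sums_unique by metis
qed

lemma moebius_series_bound:
  assumes "moebius_series f \<alpha> l" "z \<in> unit_disc"
  shows "cmod (f z) \<le> (\<Sum>n. cmod (l n))"
proof -
  have le: "cmod (l n * moebius_map (\<alpha> n) z) \<le> cmod (l n)" for n
    using assms norm_moebius_map_le_1[of "\<alpha> n" z] unfolding moebius_series_def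
    by (simp add: norm_mult mult_left_le)
  have s: "summable (\<lambda>n. cmod (l n))"
    using assms by (simp add: moebius_series_def)
  have "f z = (\<Sum>n. l n * moebius_map (\<alpha> n) z)"
    using assms by (auto simp: moebius_series_def intro: sums_unique)
  also have "cmod \<dots> \<le> (\<Sum>n. cmod (l n))"
    by (rule norm_suminf_le[OF le s])
  finally show ?thesis .
qed

lemma moebius_series_nonneg: "moebius_series f \<alpha> l \<Longrightarrow> 0 \<le> (\<Sum>n. cmod (l n))"
  by (simp add: moebius_series_def suminf_nonneg)

lemma minimal_norm_le: "moebius_series f \<alpha> l \<Longrightarrow> minimal_norm f \<le> (\<Sum>n. cmod (l n))"
  unfolding minimal_norm_def
  by (rule cInf_lower) (auto intro!: bdd_belowI[where m = 0] moebius_series_nonneg)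

lemma minimal_norm_greatest:
  assumes "f \<in> minimal_space"
    and "\<And>\<alpha> l. moebius_series f \<alpha> l \<Longrightarrow> x \<le> (\<Sum>n. cmod (l n))"
  shows "x \<le> minimal_norm f"
  unfolding minimal_norm_def
  by (rule cInf_greatest) (use assms in \<open>auto simp: minimal_space_def\<close>)

lemma minimal_space_zero: "(\<lambda>z. 0) \<in> minimal_space"
  using moebius_series_zero by (auto simp: minimal_space_def)

lemma minimal_space_add:
  "f \<in> minimal_space \<Longrightarrow> g \<in> minimal_space \<Longrightarrow> (\<lambda>z. f z + g z) \<in> minimal_space"
  unfolding minimal_space_def mem_Collect_eq
  by (intro conjI holomorphic_intros; (elim conjE exE)?)
     (simp_all, metis moebius_series_add)

lemma minimal_space_scale: "f \<in> minimal_space \<Longrightarrow> (\<lambda>z. c * f z) \<in> minimal_space"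
  unfolding minimal_space_def mem_Collect_eq
  by (intro conjI holomorphic_intros; (elim conjE exE)?)
     (simp_all, metis moebius_series_scale)

lemma norm_le_minimal_norm:
  "f \<in> minimal_space \<Longrightarrow> z \<in> unit_disc \<Longrightarrow> cmod (f z) \<le> minimal_norm f"
  by (rule minimal_norm_greatest) (auto intro: moebius_series_bound)

lemma minimal_norm_add:
  assumes "f \<in> minimal_space" "g \<in> minimal_space"
  shows "minimal_norm (\<lambda>z. f z + g z) \<le> minimal_norm f + minimal_norm g"
proof -
  have "minimal_norm (\<lambda>z. f z + g z) - (\<Sum>n. cmod (m n)) \<le> minimal_norm f"
    if g: "moebius_series g \<beta> m" for \<beta> m
  proof (rule minimal_norm_greatest[OF assms(1)])
    fix \<alpha> l
    assume "moebius_series f \<alpha> l"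
    from moebius_series_add[OF this g] obtain \<gamma> k where
      "moebius_series (\<lambda>z. f z + g z) \<gamma> k"
      "(\<Sum>n. cmod (k n)) = (\<Sum>n. cmod (l n)) + (\<Sum>n. cmod (m n))" by blast
    then show "minimal_norm (\<lambda>z. f z + g z) - (\<Sum>n. cmod (m n)) \<le> (\<Sum>n. cmod (l n))"
      using minimal_norm_le by fastforce
  qed
  then have "minimal_norm (\<lambda>z. f z + g z) - minimal_norm f \<le> minimal_norm g"
    by (intro minimal_norm_greatest[OF assms(2)]) (simp add: algebra_simps)
  then show ?thesis by simp
qed

lemma minimal_norm_zero: "minimal_norm (\<lambda>z. 0) = 0"
proof (rule antisym)
  show "minimal_norm (\<lambda>z. 0) \<le> 0" using minimal_norm_le[OF moebius_series_zero] by simp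
  show "0 \<le> minimal_norm (\<lambda>z. 0)"
    by (rule minimal_norm_greatest[OF minimal_space_zero moebius_series_nonneg])
qed

lemma minimal_norm_scale_le:
  assumes "f \<in> minimal_space"
  shows "minimal_norm (\<lambda>z. c * f z) \<le> cmod c * minimal_norm f"
proof (cases "c = 0")
  case False
  have "minimal_norm (\<lambda>z. c * f z) / cmod c \<le> minimal_norm f"
  proof (rule minimal_norm_greatest[OF assms])
    fix \<alpha> l
    assume fl: "moebius_series f \<alpha> l"
    then have "summable (\<lambda>n. cmod (l n))" by (simp add: moebius_series_def)
    with minimal_norm_le[OF moebius_series_scale[OF fl, of c]]
    have "minimal_norm (\<lambda>z. c * f z) \<le> cmod c * (\<Sum>n. cmod (l n))"
      by (simp add: norm_mult suminf_mult)
    then show "minimal_norm (\<lambda>z. c * f z) / cmod c \<le> (\<Sum>n. cmod (l n))"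
      using False by (simp add: field_simps)
  qed
  then show ?thesis using False by (simp add: field_simps)
qed (simp add: minimal_norm_zero)

lemma minimal_norm_scale:
  assumes "f \<in> minimal_space"
  shows "minimal_norm (\<lambda>z. c * f z) = cmod c * minimal_norm f"
proof (cases "c = 0")
  case False
  have "minimal_norm f \<le> minimal_norm (\<lambda>z. c * f z) / cmod c"
    using minimal_norm_scale_le[OF minimal_space_scale[OF assms, of c], of "1 / c"] False
    by (simp add: norm_divide)
  then show ?thesis
    using minimal_norm_scale_le[OF assms, of c] False by (simp add: field_simps)
qed (simp add: minimal_norm_zero)

typedef moebius_space = minimal_space
  morphisms fun_of Abs_moebius_space
  using minimal_space_zero by blast

setup_lifting type_definition_moebius_space

lift_definition scaleM :: "complex \<Rightarrow> moebius_space \<Rightarrow> moebius_space" is "\<lambda>c f z. c * f z"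
  by (rule minimal_space_scale)

instantiation moebius_space :: real_normed_vector
begin

lift_definition zero_moebius_space :: moebius_space is "\<lambda>z. 0"
  by (rule minimal_space_zero)

lift_definition plus_moebius_space :: "moebius_space \<Rightarrow> moebius_space \<Rightarrow> moebius_space"
  is "\<lambda>f g z. f z + g z"
  by (rule minimal_space_add)

lift_definition uminus_moebius_space :: "moebius_space \<Rightarrow> moebius_space" is "\<lambda>f z. - f z"
  using minimal_space_scale[of _ "-1"] by simp

definition minus_moebius_space :: "moebius_space \<Rightarrow> moebius_space \<Rightarrow> moebius_space" where
  "minus_moebius_space f g = f + - g"

definition scaleR_moebius_space :: "real \<Rightarrow> moebius_space \<Rightarrow> moebius_space" where
  "scaleR_moebius_space r f = scaleM (of_real r) f"

lift_definition norm_moebius_space :: "moebius_space \<Rightarrow> real" is minimal_norm .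

definition sgn_moebius_space :: "moebius_space \<Rightarrow> moebius_space" where
  "sgn_moebius_space f = inverse (norm f) *\<^sub>R f"

definition dist_moebius_space :: "moebius_space \<Rightarrow> moebius_space \<Rightarrow> real" where
  "dist_moebius_space f g = norm (f - g)"

definition uniformity_moebius_space :: "(moebius_space \<times> moebius_space) filter" where
  "uniformity_moebius_space = (INF e\<in>{0<..}. principal {(f, g). dist f g < e})"

definition open_moebius_space :: "moebius_space set \<Rightarrow> bool" where
  "open_moebius_space U \<longleftrightarrow> (\<forall>f\<in>U. \<forall>\<^sub>F (f', g) in uniformity. f' = f \<longrightarrow> g \<in> U)"

instance
proof
  fix f g h :: moebius_space and a b :: real
  show "f + g + h = f + (g + h)" by transfer (simp add: add.assoc)
  show "f + g = g + f" by transfer (simp add: add.commute)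
  show "0 + f = f" by transfer simp
  show "- f + f = 0" by transfer simp
  show "f - g = f + - g" by (rule minus_moebius_space_def)
  show "a *\<^sub>R (f + g) = a *\<^sub>R f + a *\<^sub>R g"
    unfolding scaleR_moebius_space_def by transfer (simp add: algebra_simps)
  show "(a + b) *\<^sub>R f = a *\<^sub>R f + b *\<^sub>R f"
    unfolding scaleR_moebius_space_def by transfer (simp add: algebra_simps)
  show "a *\<^sub>R b *\<^sub>R f = (a * b) *\<^sub>R f"
    unfolding scaleR_moebius_space_def by transfer (simp add: algebra_simps)
  show "1 *\<^sub>R f = f"
    unfolding scaleR_moebius_space_def by transfer simp
  show "sgn f = inverse (norm f) *\<^sub>R f" by (rule sgn_moebius_space_def)
  show "dist f g = norm (f - g)" by (rule dist_moebius_space_def)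
  show "norm f = 0 \<longleftrightarrow> f = 0"
  proof transfer
    fix f assume f: "f \<in> minimal_space"
    show "minimal_norm f = 0 \<longleftrightarrow> f = (\<lambda>z. 0)"
    proof
      assume 0: "minimal_norm f = 0"
      show "f = (\<lambda>z. 0)"
      proof
        fix z
        show "f z = 0"
        proof (cases "z \<in> unit_disc")
          case True
          then show ?thesis using norm_le_minimal_norm[OF f True] 0 by simp
        next
          case False
          then show ?thesis using f unfolding minimal_space_def by blast
        qed
      qed
    qed (simp add: minimal_norm_zero)
  qed
  show "norm (f + g) \<le> norm f + norm g" by transfer (rule minimal_norm_add)
  show "norm (a *\<^sub>R f) = \<bar>a\<bar> * norm f"
    unfolding scaleR_moebius_space_def by transfer (simp add: minimal_norm_scale)
qed (simp_all add: uniformity_moebius_space_def open_moebius_space_def)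

end

lemma vector_space_scaleM: "vector_space scaleM"
  by unfold_locales (transfer; simp add: algebra_simps)+

definition compact_op :: "(moebius_space \<Rightarrow> moebius_space) \<Rightarrow> bool" where
  "compact_op K \<longleftrightarrow>
     Vector_Spaces.linear scaleM scaleM K \<and> (\<forall>B. bounded B \<longrightarrow> compact (closure (K ` B)))"

definition essential_norm :: "(moebius_space \<Rightarrow> moebius_space) \<Rightarrow> real" where
  "essential_norm T = Inf {onorm (\<lambda>f. T f - K f) | K. compact_op K}"

definition compose_disc :: "(complex \<Rightarrow> complex) \<Rightarrow> moebius_space \<Rightarrow> complex \<Rightarrow> complex" where
  "compose_disc \<psi> f = (\<lambda>z. if z \<in> unit_disc then fun_of f (\<psi> z) else 0)"

text \<open>\<open>comp_op \<psi>\<close> is meaningful only if \<open>\<psi>\<close> induces a map of the space into itself,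
  i.e. if \<open>compose_disc \<psi> f \<in> minimal_space\<close> for every \<open>f\<close>.\<close>

definition comp_op :: "(complex \<Rightarrow> complex) \<Rightarrow> moebius_space \<Rightarrow> moebius_space" where
  "comp_op \<psi> f = Abs_moebius_space (compose_disc \<psi> f)"

end

theory Submission
  imports Defs
begin

text \<open>The norm of the space dominates the supremum norm, and the latter suffices. Choose
  \<open>z\<^sub>k\<close> in the disc with \<open>\<psi>(z\<^sub>k) \<rightarrow> \<eta>\<close>, \<open>\<bar>\<eta>\<bar> = 1\<close>, and test \<open>C\<^sub>\<psi> - K\<close> on \<open>\<phi>\<^sub>\<alpha>\<close> with \<open>\<alpha> \<rightarrow> \<eta>\<close>
  radially. Along a subsequence \<open>K \<phi>\<^sub>\<alpha>\<close> converges to some \<open>g\<close>, and along a subsequence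
  \<open>g(z\<^sub>k) \<rightarrow> c\<close>. Since \<open>\<phi>\<^sub>\<alpha> \<rightarrow> \<eta>\<close> pointwise on the disc whereas \<open>\<phi>\<^sub>\<alpha>(\<eta>) = -\<eta>\<close>, taking the two
  limits in either order gives \<open>\<bar>\<eta> - c\<bar> \<le> \<parallel>C\<^sub>\<psi> - K\<parallel>\<close> and \<open>\<bar>\<eta> + c\<bar> \<le> \<parallel>C\<^sub>\<psi> - K\<parallel>\<close>, whose sum is
  at least \<open>\<bar>2\<eta>\<bar> = 2\<close>.\<close>

text \<open>A zero would force \<open>cmod a * cmod z = 1\<close>. The two cases allow either the
  point or the parameter to reach the unit circle; each occurs in one of the limits below.\<close>

lemma one_minus_cnj_mult_neq_0:
  assumes "cmod a < 1 \<and> cmod z \<le> 1 \<or> cmod a \<le> 1 \<and> cmod z < 1"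
  shows "1 - cnj a * z \<noteq> 0"
proof
  assume "1 - cnj a * z = 0"
  then have "cmod a * cmod z = 1"
    by (metis complex_mod_cnj eq_iff_diff_eq_0 norm_mult norm_one)
  moreover have "cmod a * cmod z < 1"
    using assms mult_left_le[of "cmod z" "cmod a"] mult_right_le_one_le[of "cmod z" "cmod a"]
      mult_left_le_one_le[of "cmod z" "cmod a"]
    by auto
  ultimately show False by simp
qed

text \<open>The series with the single term \<open>moebius_map a\<close> and coefficient 1 witnesses
  both claims.\<close>

lemma moebius_map_in_minimal_space:
  assumes "cmod a < 1"
  shows "(\<lambda>z. if z \<in> unit_disc then moebius_map a z else 0) \<in> minimal_space"
    and "minimal_norm (\<lambda>z. if z \<in> unit_disc then moebius_map a z else 0) \<le> 1"
proof -
  let ?f = "\<lambda>z. if z \<in> unit_disc then moebius_map a z else 0"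
  let ?l = "\<lambda>n::nat. if n = 0 then 1 else 0 :: complex"
  have l: "(\<lambda>n. cmod (?l n)) sums 1"
    using sums_single[of 0 "\<lambda>_. 1::real"] by (simp add: if_distrib cong: if_cong)
  have "(\<lambda>n. ?l n * moebius_map a z) sums ?f z" if "z \<in> unit_disc" for z
    using sums_single[of 0 "\<lambda>_. moebius_map a z"] that
    by (simp add: if_distrib[where f = "\<lambda>x. x * _"] cong: if_cong)
  then have s: "moebius_series ?f (\<lambda>_. a) ?l"
    using assms sums_summable[OF l] by (auto simp: moebius_series_def)
  have "moebius_map a holomorphic_on unit_disc"
    unfolding moebius_map_def[abs_def]
    by (intro holomorphic_intros) (use assms one_minus_cnj_mult_neq_0 in auto)
  then have "?f holomorphic_on unit_disc"
    by (rule holomorphic_transform) simp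
  with s show "?f \<in> minimal_space"
    unfolding minimal_space_def by auto
  show "minimal_norm ?f \<le> 1"
    using minimal_norm_le[OF s] sums_unique[OF l] by simp
qed

lemma norm_fun_of_le: "z \<in> unit_disc \<Longrightarrow> cmod (fun_of f z) \<le> norm f"
  by transfer (rule norm_le_minimal_norm)

lemma fun_of_diff: "fun_of (f - g) z = fun_of f z - fun_of g z"
  unfolding minus_moebius_space_def by transfer simp

text \<open>The image of the unit sphere has compact closure, hence is bounded, and homogeneity does
  the rest. This is what makes \<open>onorm\<close> of a difference with \<open>K\<close> an actual
  bound.\<close>

lemma compact_op_bounded_linear:
  assumes "compact_op K"
  shows "bounded_linear K"
proof -
  interpret linear_map: Vector_Spaces.linear scaleM scaleM K
    using assms by (simp add: compact_op_def)
  have "bounded (sphere 0 1 :: moebius_space set)"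
    by (intro boundedI[where B = 1]) simp
  then have "bounded (closure (K ` sphere 0 1))"
    using assms by (intro compact_imp_bounded) (simp add: compact_op_def)
  then obtain B where B: "\<And>f. norm f = 1 \<Longrightarrow> norm (K f) \<le> B"
    using closure_subset[of "K ` sphere 0 1"] by (force simp: bounded_iff)
  have scale: "K (r *\<^sub>R f) = r *\<^sub>R K f" for r f
    by (simp add: scaleR_moebius_space_def linear_map.scale)
  show ?thesis
  proof (rule bounded_linear_intro[where K = B])
    fix f
    show "norm (K f) \<le> norm f * B"
    proof (cases "f = 0")
      case False
      then have "K f = norm f *\<^sub>R K (sgn f)"
        by (metis scale norm_eq_zero scaleR_one scaleR_scaleR sgn_div_norm right_inverse)
      then show ?thesis
        using B[of "sgn f"] False by (simp add: norm_sgn mult_left_mono)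
    qed simp
  qed (auto simp: scale linear_map.add)
qed

text \<open>Ensures that the infimum defining \<open>essential_norm\<close> is over a nonempty
  set.\<close>

lemma compact_op_zero: "compact_op (\<lambda>_. 0)"
proof -
  have "Vector_Spaces.linear scaleM scaleM (\<lambda>_. 0)"
    by (intro vector_space_pair.linear_zero) (simp add: vector_space_pair_def vector_space_scaleM)
  moreover have "compact (closure ((\<lambda>_. 0) ` B :: moebius_space set))" for B :: "moebius_space set"
    by (cases "B = {}") (simp_all add: image_constant_conv)
  ultimately show ?thesis
    by (simp add: compact_op_def)
qed

text \<open>For unimodular \<eta> the limit map is constant, as \<eta> - w = \<eta> (1 -
  \<open>cnj\<close> \<eta> w).\<close>

lemma moebius_map_tendsto_param:
  assumes "(a \<longlongrightarrow> \<eta>) F" "cmod \<eta> = 1" "cmod w < 1"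
  shows "((\<lambda>n. moebius_map (a n) w) \<longlongrightarrow> \<eta>) F"
proof -
  have nz: "1 - cnj \<eta> * w \<noteq> 0"
    using assms by (intro one_minus_cnj_mult_neq_0) simp
  have "\<eta> * cnj \<eta> = 1"
    using assms(2) complex_norm_square[of \<eta>] by simp
  then have "\<eta> * (1 - cnj \<eta> * w) = \<eta> - w"
    by algebra
  then have "(\<eta> - w) / (1 - cnj \<eta> * w) = \<eta>"
    using nz by (metis nonzero_eq_divide_eq)
  moreover have "((\<lambda>n. moebius_map (a n) w) \<longlongrightarrow> (\<eta> - w) / (1 - cnj \<eta> * w)) F"
    unfolding moebius_map_def by (intro tendsto_intros assms nz)
  ultimately show ?thesis by simp
qed

text \<open>The parameter lies on the radius through \<eta>, so the value at \<eta> is (r - 1)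
  \<eta> / (1 - r).\<close>

lemma moebius_map_radial_tendsto:
  assumes "(w \<longlongrightarrow> \<eta>) F" "cmod \<eta> = 1" "0 \<le> r" "r < 1"
  shows "((\<lambda>k. moebius_map (of_real r * \<eta>) (w k)) \<longlongrightarrow> - \<eta>) F"
proof -
  have nz: "1 - cnj (of_real r * \<eta>) * \<eta> \<noteq> 0"
    using assms by (intro one_minus_cnj_mult_neq_0) (simp add: norm_mult)
  have "- \<eta> * (1 - cnj (of_real r * \<eta>) * \<eta>) = of_real r * \<eta> - \<eta>"
    using assms(2) complex_norm_square[of \<eta>] by (simp add: algebra_simps)
  then have "(of_real r * \<eta> - \<eta>) / (1 - cnj (of_real r * \<eta>) * \<eta>) = - \<eta>"
    using nz by (metis nonzero_eq_divide_eq)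
  moreover have "((\<lambda>k. moebius_map (of_real r * \<eta>) (w k)) \<longlongrightarrow>
      (of_real r * \<eta> - \<eta>) / (1 - cnj (of_real r * \<eta>) * \<eta>)) F"
    unfolding moebius_map_def by (intro tendsto_intros assms nz)
  ultimately show ?thesis by simp
qed

text \<open>Bolzano-Weierstrass applied to the values of \<psi> along a maximizing sequence.\<close>

lemma SUP_norm_eq_1_imp_tendsto_sphere:
  fixes \<psi> :: "complex \<Rightarrow> complex"
  assumes "\<psi> ` S \<subseteq> unit_disc" "S \<noteq> {}" "(SUP z\<in>S. cmod (\<psi> z)) = 1"
  obtains z \<eta> where "\<And>k::nat. z k \<in> S" "(\<lambda>k. \<psi> (z k)) \<longlonglongrightarrow> \<eta>" "cmod \<eta> = 1"
proof -
  have lt: "cmod (\<psi> z) < 1" if "z \<in> S" for z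
    using assms(1) that by auto
  then have bdd: "bdd_above ((\<lambda>z. cmod (\<psi> z)) ` S)"
    by (auto intro!: bdd_aboveI2[where M = 1] less_imp_le)
  have "\<exists>z\<in>S. 1 - inverse (real (Suc n)) < cmod (\<psi> z)" for n
    using less_cSUP_iff[OF assms(2) bdd, of "1 - inverse (real (Suc n))"] assms(3) by simp
  then obtain x where x: "\<And>n. x n \<in> S" "\<And>n. 1 - inverse (real (Suc n)) < cmod (\<psi> (x n))"
    by metis
  have "bounded (range (\<lambda>n. \<psi> (x n)))"
    using lt x(1) by (intro boundedI[where B = 1]) (auto intro: less_imp_le)
  then obtain \<eta> r where r: "strict_mono r" "((\<lambda>n. \<psi> (x n)) \<circ> r) \<longlonglongrightarrow> \<eta>"
    using bounded_imp_convergent_subsequence by blast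
  have "(\<lambda>n. cmod (\<psi> (x n))) \<longlonglongrightarrow> 1"
  proof (rule tendsto_sandwich)
    show "(\<lambda>n. 1 - inverse (real (Suc n))) \<longlonglongrightarrow> 1"
      using tendsto_diff[OF tendsto_const LIMSEQ_inverse_real_of_nat, of 1] by simp
  qed (use x lt in \<open>auto intro!: always_eventually less_imp_le\<close>)
  then have "((\<lambda>n. cmod (\<psi> (x n))) \<circ> r) \<longlonglongrightarrow> 1"
    using r(1) by (rule LIMSEQ_subseq_LIMSEQ)
  then have "cmod \<eta> = 1"
    using LIMSEQ_unique tendsto_norm[OF r(2)] by (fastforce simp: o_def)
  with that[of "x \<circ> r" \<eta>] x(1) r(2) show thesis
    by (simp add: o_def)
qed

lemma onorm_comp_op_diff_compact_ge_1:
  assumes \<psi>: "\<psi> ` unit_disc \<subseteq> unit_disc"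
    and mem: "\<And>f. compose_disc \<psi> f \<in> minimal_space"
    and bl: "bounded_linear (comp_op \<psi>)"
    and sup: "(SUP z\<in>unit_disc. cmod (\<psi> z)) = 1"
    and K: "compact_op K"
  shows "onorm (\<lambda>f. comp_op \<psi> f - K f) \<ge> 1"
proof -
  define L where "L = onorm (\<lambda>f. comp_op \<psi> f - K f)"
  obtain z \<eta> where z: "\<And>k::nat. z k \<in> unit_disc" "(\<lambda>k. \<psi> (z k)) \<longlonglongrightarrow> \<eta>" and \<eta>: "cmod \<eta> = 1"
    using SUP_norm_eq_1_imp_tendsto_sphere[OF \<psi> _ sup] by auto
  define \<rho> where "\<rho> n = 1 - inverse (real (Suc n))" for n
  have \<rho>: "0 \<le> \<rho> n" "\<rho> n < 1" for n
    by (simp_all add: \<rho>_def field_simps)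
  have \<rho>_lim: "\<rho> \<longlonglongrightarrow> 1"
    unfolding \<rho>_def using tendsto_diff[OF tendsto_const LIMSEQ_inverse_real_of_nat, of 1] by simp
  define a where "a n = of_real (\<rho> n) * \<eta>" for n
  have a: "cmod (a n) < 1" for n
    using \<rho> \<eta> by (simp add: a_def norm_mult)
  have a_lim: "a \<longlonglongrightarrow> \<eta>"
    unfolding a_def using tendsto_mult[OF tendsto_of_real[OF \<rho>_lim] tendsto_const, of \<eta>] by simp
  define \<Phi> where
    "\<Phi> n = Abs_moebius_space (\<lambda>z. if z \<in> unit_disc then moebius_map (a n) z else 0)" for n
  have fun_\<Phi>: "fun_of (\<Phi> n) = (\<lambda>z. if z \<in> unit_disc then moebius_map (a n) z else 0)" for n
    unfolding \<Phi>_def by (intro Abs_moebius_space_inverse moebius_map_in_minimal_space a)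
  have norm_\<Phi>: "norm (\<Phi> n) \<le> 1" for n
    using moebius_map_in_minimal_space(2)[OF a[of n]] by (simp add: norm_moebius_space.rep_eq fun_\<Phi>)
  have comp: "fun_of (comp_op \<psi> (\<Phi> n)) w = moebius_map (a n) (\<psi> w)" if "w \<in> unit_disc" for n w
  proof -
    have "\<psi> w \<in> unit_disc"
      using \<psi> that by blast
    \<comment> \<open>\<open>mem\<close> is what allows \<open>Abs_moebius_space\<close> to be
      undone here.\<close>
    with that show ?thesis
      by (simp add: comp_op_def Abs_moebius_space_inverse[OF mem]) (simp add: compose_disc_def fun_\<Phi>)
  qed
  have T: "bounded_linear (\<lambda>f. comp_op \<psi> f - K f)"
    by (intro bounded_linear_sub bl compact_op_bounded_linear K)
  have "0 \<le> L"
    unfolding L_def by (rule onorm_pos_le[OF T])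
  then have L: "norm (comp_op \<psi> (\<Phi> n) - K (\<Phi> n)) \<le> L" for n
    using onorm[OF T, of "\<Phi> n"] mult_left_le[OF norm_\<Phi>[of n], of L] by (simp add: L_def)
  have "compact (closure (K ` cball 0 1))"
    using K by (simp add: compact_op_def)
  moreover have "K (\<Phi> n) \<in> closure (K ` cball 0 1)" for n
    using norm_\<Phi> closure_subset by fastforce
  ultimately obtain g r where r: "strict_mono r" and g: "((\<lambda>n. K (\<Phi> n)) \<circ> r) \<longlonglongrightarrow> g"
    unfolding compact_def by (metis (mono_tags, lifting))
  define \<epsilon> where "\<epsilon> n = norm (K (\<Phi> (r n)) - g)" for n
  have \<epsilon>: "\<epsilon> \<longlonglongrightarrow> 0"
    using g unfolding \<epsilon>_def by (simp add: o_def LIM_zero tendsto_norm_zero)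
  \<comment> \<open>The error \<open>\<epsilon> n\<close> does not depend on \<open>w\<close>, so
    the limits in \<open>n\<close> and in \<open>w\<close> can be taken in either order.\<close>
  have main: "cmod (moebius_map (a (r n)) (\<psi> w) - fun_of g w) \<le> L + \<epsilon> n"
    if w: "w \<in> unit_disc" for n w
  proof -
    have "cmod (fun_of (comp_op \<psi> (\<Phi> (r n)) - g) w) \<le> norm (comp_op \<psi> (\<Phi> (r n)) - g)"
      by (rule norm_fun_of_le[OF w])
    also have "\<dots> \<le> norm (comp_op \<psi> (\<Phi> (r n)) - K (\<Phi> (r n))) + \<epsilon> n"
      using norm_triangle_ineq[of "comp_op \<psi> (\<Phi> (r n)) - K (\<Phi> (r n))" "K (\<Phi> (r n)) - g"]
      by (simp add: \<epsilon>_def)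
    finally show ?thesis
      using L[of "r n"] by (simp add: fun_of_diff comp[OF w])
  qed
  have L_\<epsilon>: "(\<lambda>n. L + \<epsilon> n) \<longlonglongrightarrow> L"
    using tendsto_add[OF tendsto_const \<epsilon>, of L] by simp
  \<comment> \<open>Boundedness of \<open>fun_of g\<close> on the disc suffices for a cluster value
    \<open>c\<close> along \<open>z\<close>.\<close>
  have "bounded (range (\<lambda>k. fun_of g (z k)))"
    by (intro boundedI[where B = "norm g"]) (auto intro!: norm_fun_of_le z)
  then obtain c s where s: "strict_mono s" and c: "((\<lambda>k. fun_of g (z k)) \<circ> s) \<longlonglongrightarrow> c"
    using bounded_imp_convergent_subsequence by blast
  have \<psi>_lim: "(\<lambda>k. \<psi> (z (s k))) \<longlonglongrightarrow> \<eta>"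
    using LIMSEQ_subseq_LIMSEQ[OF z(2) s] by (simp add: o_def)
  \<comment> \<open>First order: the parameter tends to \<eta> with \<open>w\<close> fixed, then
    \<open>w\<close> runs through \<open>z\<close>.\<close>
  have "cmod (\<eta> - fun_of g w) \<le> L" if w: "w \<in> unit_disc" for w
  proof (rule LIMSEQ_le)
    have "(\<lambda>n. a (r n)) \<longlonglongrightarrow> \<eta>"
      using LIMSEQ_subseq_LIMSEQ[OF a_lim r] by (simp add: o_def)
    then show "(\<lambda>n. cmod (moebius_map (a (r n)) (\<psi> w) - fun_of g w)) \<longlonglongrightarrow> cmod (\<eta> - fun_of g w)"
      using subsetD[OF \<psi> imageI[OF w]] by (intro tendsto_intros moebius_map_tendsto_param \<eta>) auto
  qed (use L_\<epsilon> main[OF w] in auto)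
  then have 1: "cmod (\<eta> - c) \<le> L"
    using c z(1)
    by (intro LIMSEQ_le_const2[OF tendsto_norm[OF tendsto_diff[OF tendsto_const]]]) (auto simp: o_def)
  \<comment> \<open>Reverse order: the points approach the circle with the parameter fixed, then
    \<open>\<epsilon> n\<close> tends to 0.\<close>
  have "cmod (- \<eta> - c) \<le> L + \<epsilon> n" for n
  proof (rule LIMSEQ_le_const2)
    show "(\<lambda>k. cmod (moebius_map (a (r n)) (\<psi> (z (s k))) - fun_of g (z (s k)))) \<longlonglongrightarrow> cmod (- \<eta> - c)"
      unfolding a_def using c \<psi>_lim \<eta> \<rho>
      by (intro tendsto_intros moebius_map_radial_tendsto) (auto simp: o_def)
  qed (use main z(1) in auto)
  then have 2: "cmod (- \<eta> - c) \<le> L"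
    by (intro LIMSEQ_le_const[OF L_\<epsilon>]) auto
  \<comment> \<open>The unknown value \<open>c\<close> cancels in the difference of the two
    terms.\<close>
  have "cmod (2 * \<eta>) \<le> cmod (\<eta> - c) + cmod (- \<eta> - c)"
    using norm_triangle_ineq4[of "\<eta> - c" "- \<eta> - c"] by simp
  with 1 2 \<eta> show ?thesis
    by (simp add: norm_mult L_def)
qed

theorem corollary1:
  fixes \<psi> :: "complex \<Rightarrow> complex"
  assumes "\<psi> holomorphic_on unit_disc"
    and "\<psi> ` unit_disc \<subseteq> unit_disc"
    and "\<And>f. compose_disc \<psi> f \<in> minimal_space"
    and "bounded_linear (comp_op \<psi>)"
    and "(SUP z\<in>unit_disc. cmod (\<psi> z)) = 1"
  shows "essential_norm (comp_op \<psi>) \<ge> 1"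
  unfolding essential_norm_def
proof (rule cInf_greatest)
  show "{onorm (\<lambda>f. comp_op \<psi> f - K f) | K. compact_op K} \<noteq> {}"
    using compact_op_zero by blast
qed (use onorm_comp_op_diff_compact_ge_1[OF assms(2-5)] in auto)

end
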